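(* Let $\varphi:\mathbb{R}^n\to\mathbb{R}$ be of class $C^{1,1}$ and bounded from below, and let $x^0\in\mathbb{R}^n$ be such that for every $x\in\mathbb{R}^n$ with $\varphi(x)\le\varphi(x^0)$ the generalized Hessian $\partial^2\varphi(x)$ is positive-semidefinite. Let $\{x^k\}$ be generated by Algorithm GRNM-W (described in the context) started at $x^0$, and suppose that there are constants $m_{\mathrm{upper}}\ge m_{\mathrm{lower}}>0$ such that all the eigenvalues of all the regularization matrices $B_k$ lie in $[m_{\mathrm{lower}}^2,m_{\mathrm{upper}}^2]$. Then every accumulation point $\bar x$ of $\{x^k\}$ is a stationary point of $\varphi$, i.e., $\nabla\varphi(\bar x)=0$.
   Context: A function is of class $C^{1,1}$ if it is continuously differentiable with locally Lipschitz gradient. For a set $\Omega\subset\mathbb{R}^s$ and $\bar z\in\Omega$, the regular normal cone is $\widehat N_\Omega(\bar z)=\{v\mid \limsup_{z\to\bar z,\,z\in\Omega}\langle v,z-\bar z\rangle/\|z-\bar z\|\le 0\}$, and the limiting normal cone $N_\Omega(\bar z)$ is the set of all $v$ for which there are $z_k\to\bar z$ with $z_k\in\Omega$, and $v_k\to v$ with $v_k\in\widehat N_\Omega(z_k)$. For $\varphi$ of class $C^{1,1}$, the generalized Hessian at $x$ is the set-valued mapping $\partial^2\varphi(x):\mathbb{R}^n\rightrightarrows\mathbb{R}^n$, $\partial^2\varphi(x)(u)=\{z\mid (z,-u)\in N_{\mathrm{gph}\,\nabla\varphi}(x,\nabla\varphi(x))\}$ (the limiting coderivative of $\nabla\varphi$).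 It is positive-semidefinite if $\langle z,u\rangle\ge 0$ for all $u\in\mathbb{R}^n$ and all $z\in\partial^2\varphi(x)(u)$. Algorithm GRNM-W. Input: $x^0\in\mathbb{R}^n$, $c>0$, $0<\sigma_1<\sigma_2<1$, $\rho\in(0,1]$. For $k=0,1,\ldots$: (1) If $\nabla\varphi(x^k)=0$, stop; otherwise set $\mu_k=c\|\nabla\varphi(x^k)\|^\rho$. (2) Choose a symmetric positive-definite matrix $B_k$ and find $d^k\in\mathbb{R}^n$ with $-\nabla\varphi(x^k)\in\partial^2\varphi(x^k)(d^k)+\mu_kB_kd^k$. (3) If $\tau_k=1$ satisfies the Wolfe conditions $$\varphi(x^k+\tau_kd^k)\le\varphi(x^k)+\sigma_1\tau_k\langle\nabla\varphi(x^k),d^k\rangle,\qquad \langle\nabla\varphi(x^k+\tau_kd^k),d^k\rangle\ge\sigma_2\langle\nabla\varphi(x^k),d^k\rangle,$$ take $\tau_k=1$; otherwise take any $\tau_k>0$ satisfying them. It is assumed that the stepsizes used by the implementation are bounded above by some constant $\tau_{\max}$. (4) Set $x^{k+1}=x^k+\tau_kd^k$. *)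

theory Defs
  imports "HOL-Analysis.Analysis"
begin

definition grad :: "('a::real_inner \<Rightarrow> real) \<Rightarrow> 'a \<Rightarrow> 'a" where
  "grad f x = (THE D. GDERIV f x :> D)"

definition C11 :: "('a::real_inner \<Rightarrow> real) \<Rightarrow> bool" where
  "C11 f \<longleftrightarrow>
     (\<forall>x. f differentiable (at x)) \<and>
     continuous_on UNIV (grad f) \<and>
     (\<forall>x. \<exists>e>0. \<exists>L. L-lipschitz_on (ball x e) (grad f))"

text \<open>The limit superior is taken in the extended reals over \<open>z \<rightarrow> zbar\<close> with \<open>z \<in> \<Omega>\<close> and
  \<open>z \<noteq> zbar\<close>; at an isolated point of \<open>\<Omega>\<close> it is \<open>-\<infinity>\<close>, so every vector is a regular normal there.\<close>

definition regular_normal_cone :: "'a::real_inner set \<Rightarrow> 'a \<Rightarrow> 'a set" where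
  "regular_normal_cone \<Omega> zbar =
     {v. Limsup (at zbar within \<Omega>) (\<lambda>z. ereal (v \<bullet> (z - zbar) / norm (z - zbar))) \<le> 0}"

definition limiting_normal_cone :: "'a::real_inner set \<Rightarrow> 'a \<Rightarrow> 'a set" where
  "limiting_normal_cone \<Omega> zbar =
     {v. \<exists>z w. (\<forall>k::nat. z k \<in> \<Omega>) \<and> z \<longlonglongrightarrow> zbar \<and>
               (\<forall>k. w k \<in> regular_normal_cone \<Omega> (z k)) \<and> w \<longlonglongrightarrow> v}"

definition gph :: "('a \<Rightarrow> 'b) \<Rightarrow> ('a \<times> 'b) set" where
  "gph F = {(x, F x) | x. True}"

definition generalized_Hessian :: "('a::real_inner \<Rightarrow> real) \<Rightarrow> 'a \<Rightarrow> 'a \<Rightarrow> 'a set" where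
  "generalized_Hessian f x u =
     {z. (z, - u) \<in> limiting_normal_cone (gph (grad f)) (x, grad f x)}"

definition positive_semidefinite :: "('a::real_inner \<Rightarrow> 'a set) \<Rightarrow> bool" where
  "positive_semidefinite H \<longleftrightarrow> (\<forall>u. \<forall>z \<in> H u. z \<bullet> u \<ge> 0)"

definition sym_pos_def :: "real^'n^'n \<Rightarrow> bool" where
  "sym_pos_def B \<longleftrightarrow> transpose B = B \<and> (\<forall>u. u \<noteq> 0 \<longrightarrow> u \<bullet> (B *v u) > 0)"

definition eigenvalue :: "real^'n^'n \<Rightarrow> real \<Rightarrow> bool" where
  "eigenvalue B l \<longleftrightarrow> (\<exists>v. v \<noteq> 0 \<and> B *v v = l *\<^sub>R v)"

definition Wolfe ::
    "('a::real_inner \<Rightarrow> real) \<Rightarrow> real \<Rightarrow> real \<Rightarrow> 'a \<Rightarrow> 'a \<Rightarrow> real \<Rightarrow> bool" where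
  "Wolfe f \<sigma>1 \<sigma>2 x d t \<longleftrightarrow>
     f (x + t *\<^sub>R d) \<le> f x + \<sigma>1 * t * (grad f x \<bullet> d) \<and>
     grad f (x + t *\<^sub>R d) \<bullet> d \<ge> \<sigma>2 * (grad f x \<bullet> d)"

definition GRNM_W_step ::
    "(real^'n \<Rightarrow> real) \<Rightarrow> real \<Rightarrow> real \<Rightarrow> real \<Rightarrow> real \<Rightarrow>
     real^'n \<Rightarrow> real^'n^'n \<Rightarrow> real^'n \<Rightarrow> real \<Rightarrow> real^'n \<Rightarrow> bool" where
  "GRNM_W_step f c \<sigma>1 \<sigma>2 \<rho> x B d t x' \<longleftrightarrow>
     sym_pos_def B \<and>
     (let \<mu> = c * norm (grad f x) powr \<rho>
      in - grad f x \<in> {z + \<mu> *\<^sub>R (B *v d) | z. z \<in> generalized_Hessian f x d}) \<and>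
     (if Wolfe f \<sigma>1 \<sigma>2 x d 1 then t = 1 else t > 0 \<and> Wolfe f \<sigma>1 \<sigma>2 x d t) \<and>
     x' = x + t *\<^sub>R d"

text \<open>A run that stops at iteration \<open>k\<close> is represented by the sequence that stays at the last
  iterate \<open>x k\<close>; after stopping, nothing is required of \<open>B\<close>, \<open>d\<close> and \<open>\<tau>\<close>. The last conjunct is the
  standing assumption that the stepsizes are bounded above.\<close>

definition GRNM_W ::
    "(real^'n \<Rightarrow> real) \<Rightarrow> real^'n \<Rightarrow> real \<Rightarrow> real \<Rightarrow> real \<Rightarrow> real \<Rightarrow>
     (nat \<Rightarrow> real^'n) \<Rightarrow> (nat \<Rightarrow> real^'n^'n) \<Rightarrow> (nat \<Rightarrow> real^'n) \<Rightarrow> (nat \<Rightarrow> real) \<Rightarrow> bool" where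
  "GRNM_W f x0 c \<sigma>1 \<sigma>2 \<rho> x B d \<tau> \<longleftrightarrow>
     x 0 = x0 \<and>
     (\<forall>k. if grad f (x k) = 0 then x (Suc k) = x k
          else GRNM_W_step f c \<sigma>1 \<sigma>2 \<rho> (x k) (B k) (d k) (\<tau> k) (x (Suc k))) \<and>
     (\<exists>\<tau>max. \<forall>k. grad f (x k) \<noteq> 0 \<longrightarrow> \<tau> k \<le> \<tau>max)"

definition accumulation_point :: "(nat \<Rightarrow> 'a::topological_space) \<Rightarrow> 'a \<Rightarrow> bool" where
  "accumulation_point x xbar \<longleftrightarrow> (\<exists>r. strict_mono r \<and> (x \<circ> r) \<longlonglongrightarrow> xbar)"

end

theory Submission
  imports Defs
begin

text \<open>If \<open>\<nabla>\<phi>(xbar) \<noteq> 0\<close>, then along the subsequence converging to \<open>xbar\<close> the parameters \<open>\<mu>\<^sub>k\<close> stay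
  away from \<open>0\<close>, so \<open>-\<langle>\<nabla>\<phi>(x\<^sub>k), d\<^sub>k\<rangle> \<ge> K \<parallel>d\<^sub>k\<parallel>\<^sup>2\<close> for some \<open>K > 0\<close>, and the directions are bounded.
  Sufficient decrease and boundedness of the stepsizes force \<open>\<parallel>x\<^sub>k\<^sub>+\<^sub>1 - x\<^sub>k\<parallel> \<rightarrow> 0\<close>, whence both
  gradients in the curvature condition converge to \<open>\<nabla>\<phi>(xbar)\<close> and \<open>\<langle>\<nabla>\<phi>(x\<^sub>k), d\<^sub>k\<rangle> \<rightarrow> 0\<close>. Therefore
  \<open>d\<^sub>k \<rightarrow> 0\<close>. Elements of \<open>\<partial>\<^sup>2\<phi>(x\<^sub>k)(d\<^sub>k)\<close> are bounded by \<open>L \<parallel>d\<^sub>k\<parallel>\<close> with \<open>L\<close> a local Lipschitz constant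
  of \<open>\<nabla>\<phi>\<close>, so the Newton equation gives \<open>\<nabla>\<phi>(x\<^sub>k) \<rightarrow> 0\<close>, a contradiction.\<close>

section \<open>Eigenvalue bounds for symmetric matrices\<close>

text \<open>A zero \<open>v\<close> of the form minimizes it. Moving from \<open>v\<close> along
  \<open>- f v\<close> changes the form at first order by \<open>- 2 * t\<close> times the squared
  norm of \<open>f v\<close>, so it would turn negative if \<open>f v\<close> were nonzero.\<close>

lemma symmetric_psd_form_zero_imp_zero:
  fixes f :: "'a::real_inner \<Rightarrow> 'a"
  assumes "linear f" and sym: "\<And>u w. u \<bullet> f w = f u \<bullet> w"
    and psd: "\<And>u. 0 \<le> u \<bullet> f u" and v: "v \<bullet> f v = 0"
  shows "f v = 0"
proof (rule ccontr)
  assume "f v \<noteq> 0"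
  define w where "w = f v"
  define p where "p = w \<bullet> w"
  define q where "q = w \<bullet> f w"
  have p: "p > 0" using \<open>f v \<noteq> 0\<close> by (simp add: p_def w_def)
  have q: "q \<ge> 0" using psd by (simp add: q_def)
  have expand: "(v - t *\<^sub>R w) \<bullet> f (v - t *\<^sub>R w) = - 2 * t * p + t\<^sup>2 * q" for t
  proof -
    have "v \<bullet> f w = p" by (simp add: sym p_def w_def)
    moreover have "f (v - t *\<^sub>R w) = w - t *\<^sub>R f w"
      using \<open>linear f\<close> by (simp add: linear_diff linear_scale w_def)
    moreover have "v \<bullet> w = 0" using v by (simp add: w_def)
    ultimately show ?thesis
      unfolding p_def q_def
      by (simp only: inner_diff_left inner_diff_right inner_scaleR_left inner_scaleR_right
          power2_eq_square) (simp add: algebra_simps)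
  qed
  \<comment> \<open>Close to the minimizer \<open>p / q\<close> of the quadratic in
    \<open>t\<close>; the added 1 covers \<open>q = 0\<close>.\<close>
  define t where "t = p / (q + 1)"
  have t: "t > 0" using p q by (simp add: t_def)
  have "t * (q + 1) = p" using q by (simp add: t_def)
  then have tq: "t * q = p - t" by (simp add: algebra_simps)
  have "- 2 * t * p + t\<^sup>2 * q = t * (t * q - 2 * p)"
    by (simp add: power2_eq_square algebra_simps)
  also have "\<dots> = t * (- p - t)" by (simp add: tq)
  also have "\<dots> < 0" using t p by (intro mult_pos_neg) auto
  finally show False using expand[of t] psd[of "v - t *\<^sub>R w"] by linarith
qed

text \<open>The form attains its minimum \<open>l\<close> over the compact unit sphere at some
  \<open>v\<close>. The shifted map \<open>f u - l *\<^sub>R u\<close> then has a nonnegative form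
  vanishing at \<open>v\<close>, so it kills \<open>v\<close>.\<close>

lemma symmetric_linear_least_eigenvalue:
  fixes f :: "'a::euclidean_space \<Rightarrow> 'a"
  assumes lin: "linear f" and sym: "\<And>u w. u \<bullet> f w = f u \<bullet> w"
  obtains l v where "v \<noteq> 0" "f v = l *\<^sub>R v" "\<And>u. l * (u \<bullet> u) \<le> u \<bullet> f u"
proof -
  have "continuous_on (sphere 0 1) (\<lambda>u. u \<bullet> f u)"
    by (intro continuous_on_inner linear_continuous_on_compose[OF _ lin] continuous_on_id)
  moreover have "sphere (0::'a) 1 \<noteq> {}" by simp
  ultimately obtain v where v: "v \<in> sphere 0 1"
    and min: "\<And>u. u \<in> sphere 0 1 \<Longrightarrow> v \<bullet> f v \<le> u \<bullet> f u"
    using continuous_attains_inf[OF compact_sphere, of "0::'a" 1 "\<lambda>u. u \<bullet> f u"] by blast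
  define l where "l = v \<bullet> f v"
  have rayleigh: "l * (u \<bullet> u) \<le> u \<bullet> f u" for u
  proof (cases "u = 0")
    case True
    then show ?thesis by simp
  next
    case False
    define s where "s = norm u"
    have s: "s > 0" using False by (simp add: s_def)
    have "l \<le> (u /\<^sub>R s) \<bullet> f (u /\<^sub>R s)"
      using min[of "u /\<^sub>R s"] s by (simp add: l_def s_def)
    also have "\<dots> = (u \<bullet> f u) / s\<^sup>2"
      by (simp add: linear_scale[OF lin] power2_eq_square divide_inverse)
    finally show ?thesis
      using s by (simp add: pos_le_divide_eq s_def dot_square_norm)
  qed
  have "f v - l *\<^sub>R v = 0"
  proof (rule symmetric_psd_form_zero_imp_zero[where f = "\<lambda>u. f u - l *\<^sub>R u"])
    show "linear (\<lambda>u. f u - l *\<^sub>R u)"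
      by (intro linear_compose_sub lin linear_scaleR)
    show "u \<bullet> (f w - l *\<^sub>R w) = (f u - l *\<^sub>R u) \<bullet> w" for u w
      by (simp add: inner_diff_left inner_diff_right sym)
    show "0 \<le> u \<bullet> (f u - l *\<^sub>R u)" for u
      using rayleigh[of u] by (simp add: inner_diff_right)
    show "v \<bullet> (f v - l *\<^sub>R v) = 0"
      using v by (simp add: inner_diff_right l_def dot_square_norm)
  qed
  moreover have "v \<noteq> 0" using v by auto
  ultimately show thesis using that rayleigh by auto
qed

lemma symmetric_matrix_inner:
  fixes B :: "real^'n^'n"
  assumes "transpose B = B"
  shows "u \<bullet> (B *v w) = (B *v u) \<bullet> w"
  using dot_lmul_matrix[of u B w] vector_transpose_matrix[of u B] assms by metis

lemma symmetric_matrix_quadratic_form_lower: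
  fixes B :: "real^'n^'n"
  assumes "transpose B = B" and "\<And>l. eigenvalue B l \<Longrightarrow> m \<le> l"
  shows "m * (norm u)\<^sup>2 \<le> u \<bullet> (B *v u)"
proof -
  obtain l v where "v \<noteq> 0" "B *v v = l *\<^sub>R v" and l: "\<And>u. l * (u \<bullet> u) \<le> u \<bullet> (B *v u)"
    using symmetric_linear_least_eigenvalue[of "(*v) B"] symmetric_matrix_inner[OF assms(1)]
      matrix_vector_mul_linear[of B] by metis
  then have "m \<le> l" using assms(2) by (auto simp: eigenvalue_def)
  then have "m * (u \<bullet> u) \<le> l * (u \<bullet> u)" by (intro mult_right_mono) auto
  then show ?thesis using l[of u] by (simp add: dot_square_norm)
qed

text \<open>The least eigenvalue of \<open>- B\<close> is minus the greatest eigenvalue of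
  \<open>B\<close>.\<close>

lemma symmetric_matrix_quadratic_form_upper:
  fixes B :: "real^'n^'n"
  assumes "transpose B = B" and "\<And>l. eigenvalue B l \<Longrightarrow> l \<le> M"
  shows "u \<bullet> (B *v u) \<le> M * (norm u)\<^sup>2"
proof -
  obtain l v where v: "v \<noteq> 0" "- (B *v v) = l *\<^sub>R v"
    and l: "\<And>u. l * (u \<bullet> u) \<le> u \<bullet> - (B *v u)"
  proof (rule symmetric_linear_least_eigenvalue[of "\<lambda>u. - (B *v u)"])
    show "linear (\<lambda>u. - (B *v u))"
      by (intro linear_compose_neg matrix_vector_mul_linear)
    show "u \<bullet> - (B *v w) = - (B *v u) \<bullet> w" for u w
      using symmetric_matrix_inner[OF assms(1), of u w] by simp
  qed (rule that)
  have "B *v v = (- l) *\<^sub>R v" using v(2) by (metis minus_minus scaleR_minus_left)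
  then have "- l \<le> M" using assms(2)[of "- l"] v(1) unfolding eigenvalue_def by blast
  then have "- l * (u \<bullet> u) \<le> M * (u \<bullet> u)" by (intro mult_right_mono) auto
  then show ?thesis using l[of u] by (simp add: dot_square_norm)
qed

text \<open>Polarization writes \<open>w \<bullet> (B *v u)\<close> as a difference of two form
  values. Since the form is nonnegative, the difference is at most the sum, to which the upper form
  bound and the parallelogram law apply.\<close>

lemma sym_pos_def_norm_mult_le:
  fixes B :: "real^'n^'n"
  assumes B: "sym_pos_def B" and "\<And>l. eigenvalue B l \<Longrightarrow> l \<le> M"
  shows "norm (B *v u) \<le> M * norm u"
proof (cases "B *v u = 0 \<or> u = 0")
  case True
  have "0 \<le> u \<bullet> (B *v u)" using B by (cases "u = 0") (auto simp: sym_pos_def_def less_imp_le)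
  then have "0 \<le> M * (norm u)\<^sup>2"
    using symmetric_matrix_quadratic_form_upper[of B M u] assms by (auto simp: sym_pos_def_def)
  then have "0 \<le> M * norm u" by (auto simp: zero_le_mult_iff)
  then show ?thesis using True by auto
next
  case False
  have t: "transpose B = B" using B by (simp add: sym_pos_def_def)
  have psd: "0 \<le> w \<bullet> (B *v w)" for w
    using B by (cases "w = 0") (auto simp: sym_pos_def_def less_imp_le)
  define s where "s = norm u"
  \<comment> \<open>The vector \<open>B *v u\<close> rescaled to the length of \<open>u\<close>: the
    direction makes the inner product equal to \<open>s * norm (B *v u)\<close>, and the equal
    lengths give exactly the constant \<open>M\<close>.\<close>
  define w where "w = (s / norm (B *v u)) *\<^sub>R (B *v u)"
  have s: "s > 0" using False by (simp add: s_def)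
  have nw: "norm w = s" using False s by (simp add: w_def)
  have wB: "w \<bullet> (B *v u) = s * norm (B *v u)"
    using False by (simp add: w_def dot_square_norm power2_eq_square)
  have "u \<bullet> (B *v w) = w \<bullet> (B *v u)"
    by (metis symmetric_matrix_inner[OF t] inner_commute)
  then have "4 * (w \<bullet> (B *v u)) =
      (w + u) \<bullet> (B *v (w + u)) - (w - u) \<bullet> (B *v (w - u))"
    by (simp only: inner_add_left inner_add_right inner_diff_left inner_diff_right
        matrix_vector_right_distrib matrix_vector_mult_diff_distrib)
  also have "\<dots> \<le> (w + u) \<bullet> (B *v (w + u)) + (w - u) \<bullet> (B *v (w - u))"
    using psd[of "w - u"] by linarith
  also have "\<dots> \<le> M * (norm (w + u))\<^sup>2 + M * (norm (w - u))\<^sup>2"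
    using assms t by (intro add_mono symmetric_matrix_quadratic_form_upper) auto
  also have "\<dots> = M * (2 * (norm w)\<^sup>2 + 2 * (norm u)\<^sup>2)"
    by (simp add: power2_norm_eq_inner inner_simps inner_commute algebra_simps)
  also have "\<dots> = 4 * (s * (M * s))" by (simp add: nw s_def power2_eq_square)
  finally have "s * norm (B *v u) \<le> s * (M * s)" by (simp add: wB)
  then show ?thesis using s by (simp add: s_def)
qed

section \<open>Norm bound for the generalized Hessian\<close>

text \<open>Follow the graph while the base point moves a distance \<open>h\<close> along
  \<open>p\<close>. The first component contributes \<open>norm p * h\<close>, the second can offset
  at most \<open>norm q * (L * h)\<close>, and regular normality allows only a total that is small
  relative to \<open>h\<close>.\<close>

lemma regular_normal_cone_gph_lipschitz:
  fixes F :: "'a::real_inner \<Rightarrow> 'b::real_inner"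
  assumes L: "L-lipschitz_on U F" and "open U" "y \<in> U"
    and n: "(p, q) \<in> regular_normal_cone (gph F) (y, F y)"
  shows "norm p \<le> L * norm q"
proof (cases "p = 0")
  case True
  then show ?thesis using lipschitz_on_nonneg[OF L] by simp
next
  case False
  let ?Q = "\<lambda>z. ((p, q) \<bullet> (z - (y, F y))) / norm (z - (y, F y))"
  have L0: "L \<ge> 0" by (rule lipschitz_on_nonneg[OF L])
  show ?thesis
  proof (rule field_le_epsilon)
    fix e :: real assume "e > 0"
    \<comment> \<open>The graph displacement has norm at most \<open>(1 + L) * h\<close>; this
      choice turns the error into \<open>e * h\<close>.\<close>
    define \<epsilon> where "\<epsilon> = e / (1 + L)"
    have \<epsilon>: "\<epsilon> > 0" using \<open>e > 0\<close> L0 by (simp add: \<epsilon>_def)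
    have "Limsup (at (y, F y) within gph F) (\<lambda>z. ereal (?Q z)) < ereal \<epsilon>"
      using n \<epsilon> by (auto simp: regular_normal_cone_def intro: le_less_trans)
    then have "eventually (\<lambda>z. ereal (?Q z) < ereal \<epsilon>) (at (y, F y) within gph F)"
      by (rule Limsup_lessD)
    then obtain r where r: "r > 0"
      and Q: "\<And>z. z \<in> gph F \<Longrightarrow> z \<noteq> (y, F y) \<Longrightarrow> dist z (y, F y) < r \<Longrightarrow> ?Q z < \<epsilon>"
      unfolding eventually_at by auto
    obtain s where s: "s > 0" "ball y s \<subseteq> U"
      using \<open>open U\<close> \<open>y \<in> U\<close> by (meson openE)
    \<comment> \<open>The first bound keeps \<open>y'\<close> in \<open>U\<close>, the second keeps
      the graph point within distance \<open>r\<close>.\<close>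
    define h where "h = min (s / 2) (r / (2 * (1 + L)))"
    have h: "h > 0" using s r L0 by (simp add: h_def)
    have hs: "h < s" using s by (simp add: h_def)
    have "h \<le> r / (2 * (1 + L))" by (simp add: h_def)
    then have hr: "(1 + L) * h < r"
      using L0 r by (simp add: field_simps) 
    define y' where "y' = y + (h / norm p) *\<^sub>R p"
    have ny: "norm (y' - y) = h" using False h by (simp add: y'_def)
    have "y' \<in> U" using s(2) ny hs by (auto simp: dist_norm norm_minus_commute)
    then have nF: "norm (F y' - F y) \<le> L * h"
      using lipschitz_onD[OF L, of y' y] \<open>y \<in> U\<close> ny by (simp add: dist_norm)
    define z where "z = (y', F y')"
    have nz: "norm (z - (y, F y)) \<le> (1 + L) * h"
      using norm_Pair_le[of "y' - y" "F y' - F y"] ny nF by (simp add: z_def algebra_simps)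
    have "y' \<noteq> y" using ny h by auto
    then have zne: "z \<noteq> (y, F y)" by (simp add: z_def)
    then have "?Q z < \<epsilon>"
      using nz hr by (intro Q) (auto simp: z_def gph_def dist_norm)
    then have "(p, q) \<bullet> (z - (y, F y)) < \<epsilon> * norm (z - (y, F y))"
      using zne by (simp add: pos_divide_less_eq)
    also have "\<dots> \<le> \<epsilon> * ((1 + L) * h)" using nz \<epsilon> by (intro mult_left_mono) auto
    also have "\<dots> = e * h" using L0 by (simp add: \<epsilon>_def)
    finally have less: "p \<bullet> (y' - y) + q \<bullet> (F y' - F y) < e * h" by (simp add: z_def)
    have "p \<bullet> (y' - y) = norm p * h"
      using False by (simp add: y'_def dot_square_norm power2_eq_square)
    moreover have "\<bar>q \<bullet> (F y' - F y)\<bar> \<le> norm q * (L * h)"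
      using Cauchy_Schwarz_ineq2[of q "F y' - F y"] mult_left_mono[OF nF, of "norm q"] by simp
    ultimately have "norm p * h < (L * norm q + e) * h"
      using less by (simp add: algebra_simps)
    then show "norm p \<le> L * norm q + e" using h by simp
  qed
qed

text \<open>Limiting normals are limits of regular normals at graph points whose base points
  eventually lie in \<open>U\<close>; the bound for regular normals survives the limit.\<close>

lemma generalized_Hessian_norm_le:
  assumes L: "L-lipschitz_on U (grad f)" and U: "open U" "x \<in> U"
    and z: "z \<in> generalized_Hessian f x u"
  shows "norm z \<le> L * norm u"
proof -
  obtain a w where a: "\<And>k. a k \<in> gph (grad f)" "a \<longlonglongrightarrow> (x, grad f x)"
    and w: "\<And>k::nat. w k \<in> regular_normal_cone (gph (grad f)) (a k)" "w \<longlonglongrightarrow> (z, - u)"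
    using z by (auto simp: generalized_Hessian_def limiting_normal_cone_def)
  have a_eq: "a k = (fst (a k), grad f (fst (a k)))" for k
    using a(1)[of k] by (auto simp: gph_def)
  have "(\<lambda>k. fst (a k)) \<longlonglongrightarrow> x" using tendsto_fst[OF a(2)] by simp
  then have "eventually (\<lambda>k. fst (a k) \<in> U) sequentially"
    using U by (rule topological_tendstoD)
  then have "eventually (\<lambda>k. norm (fst (w k)) \<le> L * norm (snd (w k))) sequentially"
  proof eventually_elim
    case (elim k)
    show ?case
      using w(1)[of k] a_eq[of k]
      by (intro regular_normal_cone_gph_lipschitz[OF L U(1) elim]) (metis prod.collapse)
  qed
  moreover have "(\<lambda>k. norm (fst (w k))) \<longlonglongrightarrow> norm z"
    using tendsto_norm[OF tendsto_fst[OF w(2)]] by simp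
  moreover have "(\<lambda>k. L * norm (snd (w k))) \<longlonglongrightarrow> L * norm u"
    using tendsto_mult_left[OF tendsto_norm[OF tendsto_snd[OF w(2)]]] by simp
  ultimately show ?thesis by (intro tendsto_le[OF sequentially_bot]) auto
qed

section \<open>Consequences of the Newton equation for one step\<close>

text \<open>Pair the Newton equation with \<open>d\<close>: the Hessian term has a favourable sign,
  and the regularization term supplies the quadratic bound.\<close>

lemma GRNM_W_step_descent_direction:
  assumes step: "GRNM_W_step f c \<sigma>1 \<sigma>2 \<rho> x B d t x'"
    and psd: "positive_semidefinite (generalized_Hessian f x)"
    and "c > 0" and eig: "\<And>l. eigenvalue B l \<Longrightarrow> m \<le> l"
  shows "grad f x \<bullet> d \<le> - (c * norm (grad f x) powr \<rho> * m * (norm d)\<^sup>2)"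
proof -
  define \<mu> where "\<mu> = c * norm (grad f x) powr \<rho>"
  obtain z where z: "z \<in> generalized_Hessian f x d" "- grad f x = z + \<mu> *\<^sub>R (B *v d)"
    and B: "sym_pos_def B"
    using step by (auto simp: GRNM_W_step_def Let_def \<mu>_def)
  have "0 \<le> z \<bullet> d" using psd z(1) by (auto simp: positive_semidefinite_def)
  moreover have "- (grad f x \<bullet> d) = z \<bullet> d + \<mu> * (d \<bullet> (B *v d))"
    using arg_cong[OF z(2), of "\<lambda>v. v \<bullet> d"] by (simp add: inner_simps inner_commute)
  moreover have "\<mu> * (m * (norm d)\<^sup>2) \<le> \<mu> * (d \<bullet> (B *v d))"
    using B eig \<open>c > 0\<close>
    by (intro mult_left_mono symmetric_matrix_quadratic_form_lower)
      (auto simp: sym_pos_def_def \<mu>_def)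
  ultimately show ?thesis by (simp add: \<mu>_def mult.assoc)
qed

text \<open>Take norms in the Newton equation, bounding the Hessian element through \<open>L\<close>
  and the regularization term through \<open>M\<close>. Short directions thus force small
  gradients.\<close>

lemma GRNM_W_step_norm_grad_le:
  assumes step: "GRNM_W_step f c \<sigma>1 \<sigma>2 \<rho> x B d t x'"
    and L: "L-lipschitz_on U (grad f)" and U: "open U" "x \<in> U"
    and "c > 0" and eig: "\<And>l. eigenvalue B l \<Longrightarrow> l \<le> M"
  shows "norm (grad f x) \<le> (L + c * norm (grad f x) powr \<rho> * M) * norm d"
proof -
  define \<mu> where "\<mu> = c * norm (grad f x) powr \<rho>"
  obtain z where z: "z \<in> generalized_Hessian f x d" "- grad f x = z + \<mu> *\<^sub>R (B *v d)"
    and B: "sym_pos_def B"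
    using step by (auto simp: GRNM_W_step_def Let_def \<mu>_def)
  have \<mu>: "\<mu> \<ge> 0" using \<open>c > 0\<close> by (simp add: \<mu>_def)
  have "norm (grad f x) = norm (z + \<mu> *\<^sub>R (B *v d))" using z(2) by (metis norm_minus_cancel)
  also have "\<dots> \<le> norm z + \<mu> * norm (B *v d)"
    using norm_triangle_ineq[of z "\<mu> *\<^sub>R (B *v d)"] \<mu> by simp
  also have "\<dots> \<le> L * norm d + \<mu> * (M * norm d)"
    using B eig \<mu> generalized_Hessian_norm_le[OF L U z(1)]
    by (intro add_mono mult_left_mono sym_pos_def_norm_mult_le) auto
  finally show ?thesis by (simp add: \<mu>_def algebra_simps)
qed

theorem theorem5:
  fixes \<phi> :: "real^'n \<Rightarrow> real"
    and x0 xbar :: "real^'n"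
    and c \<sigma>1 \<sigma>2 \<rho> m_lower m_upper :: real
    and x d :: "nat \<Rightarrow> real^'n"
    and B :: "nat \<Rightarrow> real^'n^'n"
    and \<tau> :: "nat \<Rightarrow> real"
  assumes "C11 \<phi>"
    and "bdd_below (range \<phi>)"
    and "\<And>y. \<phi> y \<le> \<phi> x0 \<Longrightarrow> positive_semidefinite (generalized_Hessian \<phi> y)"
    and "c > 0"
    and "0 < \<sigma>1" and "\<sigma>1 < \<sigma>2" and "\<sigma>2 < 1"
    and "0 < \<rho>" and "\<rho> \<le> 1"
    and "GRNM_W \<phi> x0 c \<sigma>1 \<sigma>2 \<rho> x B d \<tau>"
    and "0 < m_lower" and "m_lower \<le> m_upper"
    and "\<And>k l. grad \<phi> (x k) \<noteq> 0 \<Longrightarrow> eigenvalue (B k) l \<Longrightarrow> l \<in> {m_lower\<^sup>2..m_upper\<^sup>2}"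
    and "accumulation_point x xbar"
  shows "grad \<phi> xbar = 0"
proof (rule ccontr)
  assume nonzero: "grad \<phi> xbar \<noteq> 0"
  let ?G = "\<lambda>k. grad \<phi> (x k)"
  let ?a = "\<lambda>k. - (?G k \<bullet> d k)"

  \<comment> \<open>Descent of the function values\<close>
  have step: "GRNM_W_step \<phi> c \<sigma>1 \<sigma>2 \<rho> (x k) (B k) (d k) (\<tau> k) (x (Suc k))"
    if "?G k \<noteq> 0" for k
    using assms(10) that by (simp add: GRNM_W_def)
  have stay: "x (Suc k) = x k" if "?G k = 0" for k
    using assms(10) that by (simp add: GRNM_W_def)
  obtain \<tau>max where \<tau>max: "\<And>k. ?G k \<noteq> 0 \<Longrightarrow> \<tau> k \<le> \<tau>max"
    using assms(10) by (auto simp: GRNM_W_def)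
  have \<tau>_pos: "\<tau> k > 0" and wolfe: "Wolfe \<phi> \<sigma>1 \<sigma>2 (x k) (d k) (\<tau> k)"
    and next_iterate: "x (Suc k) = x k + \<tau> k *\<^sub>R d k" if "?G k \<noteq> 0" for k
    using step[OF that] by (auto simp: GRNM_W_step_def split: if_splits)
  have decrease: "\<phi> (x (Suc k)) \<le> \<phi> (x k) - \<sigma>1 * (\<tau> k * ?a k)"
    and curvature: "(1 - \<sigma>2) * ?a k \<le> (grad \<phi> (x (Suc k)) - ?G k) \<bullet> d k"
    if "?G k \<noteq> 0" for k
    using wolfe[OF that] next_iterate[OF that]
    by (auto simp: Wolfe_def inner_diff_left algebra_simps)
  have descent: "c * norm (?G k) powr \<rho> * m_lower\<^sup>2 * (norm (d k))\<^sup>2 \<le> ?a k"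
    if "?G k \<noteq> 0" "\<phi> (x k) \<le> \<phi> x0" for k
    using GRNM_W_step_descent_direction[OF step[OF that(1)] assms(3)[OF that(2)] \<open>c > 0\<close>,
        of "m_lower\<^sup>2"] assms(13)[OF that(1)] by fastforce
  \<comment> \<open>Positive-semidefiniteness is available only on the initial level set, so descent
    is first proved under that condition; the induction for \<open>level\<close> then discharges
    it.\<close>
  have mono_step: "\<phi> (x (Suc k)) \<le> \<phi> (x k)" if "\<phi> (x k) \<le> \<phi> x0" for k
  proof (cases "?G k = 0")
    case True
    then show ?thesis by (simp add: stay)
  next
    case False
    have "0 \<le> c * norm (?G k) powr \<rho> * m_lower\<^sup>2 * (norm (d k))\<^sup>2"
      using \<open>c > 0\<close> by simp
    then have "0 \<le> ?a k" using descent[OF False that] by linarith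
    then have "0 \<le> \<sigma>1 * (\<tau> k * ?a k)"
      using \<tau>_pos[OF False] \<open>0 < \<sigma>1\<close> by (intro mult_nonneg_nonneg) auto
    then show ?thesis using decrease[OF False] by linarith
  qed
  have level: "\<phi> (x k) \<le> \<phi> x0" for k
  proof (induction k)
    case 0
    then show ?case using assms(10) by (simp add: GRNM_W_def)
  next
    case (Suc k)
    then show ?case using mono_step[OF Suc] by linarith
  qed
  have "decseq (\<lambda>k. \<phi> (x k))" by (intro decseq_SucI mono_step level)
  moreover obtain b where "\<And>y. b \<le> \<phi> y" using assms(2) by (auto simp: bdd_below_def)
  ultimately obtain l where l: "(\<lambda>k. \<phi> (x k)) \<longlonglongrightarrow> l"
    using decseq_convergent[of "\<lambda>k. \<phi> (x k)" b] by blast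

  \<comment> \<open>Estimates along the convergent subsequence\<close>
  obtain r where r: "strict_mono r" "(x \<circ> r) \<longlonglongrightarrow> xbar"
    using assms(14) by (auto simp: accumulation_point_def)
  \<comment> \<open>The decrease over a single iteration from index \<open>r j\<close>, hence
    \<open>Suc (r j)\<close> and not \<open>r (Suc j)\<close>. It vanishes because the whole
    sequence of values converges.\<close>
  define \<Delta> where "\<Delta> j = \<phi> (x (r j)) - \<phi> (x (Suc (r j)))" for j
  have \<Delta>: "\<Delta> \<longlonglongrightarrow> 0"
  proof -
    have "(\<lambda>k. \<phi> (x k) - \<phi> (x (Suc k))) \<longlonglongrightarrow> l - l"
      by (intro tendsto_diff l LIMSEQ_Suc)
    from LIMSEQ_subseq_LIMSEQ[OF this r(1)] show ?thesis by (simp add: \<Delta>_def[abs_def] o_def)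
  qed
  have contG: "continuous (at y) (grad \<phi>)" for y
    using assms(1) by (simp add: C11_def continuous_on_eq_continuous_at)
  have xr: "(\<lambda>j. x (r j)) \<longlonglongrightarrow> xbar" using r(2) by (simp add: o_def)
  have G: "(\<lambda>j. ?G (r j)) \<longlonglongrightarrow> grad \<phi> xbar"
    by (rule isCont_tendsto_compose[OF contG xr])
  define \<gamma> where "\<gamma> = norm (grad \<phi> xbar)"
  have \<gamma>: "\<gamma> > 0" using nonzero by (simp add: \<gamma>_def)
  have nG: "(\<lambda>j. norm (?G (r j))) \<longlonglongrightarrow> \<gamma>"
    unfolding \<gamma>_def by (rule tendsto_norm[OF G])
  have ev_lower: "eventually (\<lambda>j. \<gamma> / 2 < norm (?G (r j))) sequentially"
    using \<gamma> by (intro order_tendstoD(1)[OF nG]) auto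
  have ev_upper: "eventually (\<lambda>j. norm (?G (r j)) < 2 * \<gamma>) sequentially"
    using \<gamma> by (intro order_tendstoD(2)[OF nG]) auto
  \<comment> \<open>A lower bound for the coefficient in \<open>descent\<close> once the gradient
    norm exceeds \<open>\<gamma> / 2\<close>.\<close>
  define K where "K = c * (\<gamma> / 2) powr \<rho> * m_lower\<^sup>2"
  have K: "K > 0" using \<open>c > 0\<close> \<gamma> \<open>0 < m_lower\<close> by (simp add: K_def)
  have ev_descent: "eventually (\<lambda>j. ?G (r j) \<noteq> 0 \<and> K * (norm (d (r j)))\<^sup>2 \<le> ?a (r j)) sequentially"
    using ev_lower
  proof eventually_elim
    case (elim j)
    then have nz: "?G (r j) \<noteq> 0" using \<gamma> by auto
    have "(\<gamma> / 2) powr \<rho> \<le> norm (?G (r j)) powr \<rho>"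
      using elim \<gamma> \<open>0 < \<rho>\<close> by (intro powr_mono2) auto
    then have "K * (norm (d (r j)))\<^sup>2 \<le> c * norm (?G (r j)) powr \<rho> * m_lower\<^sup>2 * (norm (d (r j)))\<^sup>2"
      unfolding K_def using \<open>c > 0\<close> by (intro mult_right_mono mult_left_mono) auto
    then show ?case using descent[OF nz level] nz by linarith
  qed
  \<comment> \<open>By Cauchy-Schwarz the quadratic lower bound is at most
    \<open>2 * \<gamma>\<close> times the length of the direction; one factor of that length
    cancels.\<close>
  have ev_bounded: "eventually (\<lambda>j. norm (d (r j)) \<le> 2 * \<gamma> / K) sequentially"
    using ev_descent ev_upper
  proof eventually_elim
    case (elim j)
    let ?n = "norm (d (r j))"
    have "K * ?n\<^sup>2 \<le> norm (?G (r j)) * ?n"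
      using elim(1) Cauchy_Schwarz_ineq2[of "?G (r j)" "d (r j)"] by linarith
    also have "\<dots> \<le> 2 * \<gamma> * ?n" using elim(2) by (intro mult_right_mono) auto
    finally have "?n * (K * ?n) \<le> ?n * (2 * \<gamma>)" by (simp add: power2_eq_square mult_ac)
    then have "?n = 0 \<or> K * ?n \<le> 2 * \<gamma>" by (auto simp: mult_le_cancel_left)
    then show ?case using K \<gamma> by (auto simp: field_simps)
  qed
  \<comment> \<open>The squared step length is \<open>\<tau>\<close> times \<open>\<tau>\<close>
    times the squared direction norm. One stepsize is absorbed by \<open>\<tau>max\<close>; the
    remaining product is controlled by \<open>\<Delta>\<close> through sufficient decrease.\<close>
  have step_to_0: "(\<lambda>j. x (Suc (r j)) - x (r j)) \<longlonglongrightarrow> 0"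
  proof -
    have "eventually (\<lambda>j. norm ((norm (x (Suc (r j)) - x (r j)))\<^sup>2) \<le> \<tau>max / (K * \<sigma>1) * \<Delta> j)
      sequentially"
      using ev_descent
    proof eventually_elim
      case (elim j)
      let ?k = "r j"
      have nz: "?G ?k \<noteq> 0" using elim by simp
      have \<tau>: "0 < \<tau> ?k" "\<tau> ?k \<le> \<tau>max" using \<tau>_pos \<tau>max nz by auto
      have "\<sigma>1 * (\<tau> ?k * (K * (norm (d ?k))\<^sup>2)) \<le> \<sigma>1 * (\<tau> ?k * ?a ?k)"
        using elim \<tau> \<open>0 < \<sigma>1\<close> by (intro mult_left_mono) auto
      also have "\<dots> \<le> \<Delta> j" using decrease[OF nz] by (simp add: \<Delta>_def)
      finally have "\<tau> ?k * (norm (d ?k))\<^sup>2 \<le> \<Delta> j / (K * \<sigma>1)"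
        using K \<open>0 < \<sigma>1\<close> by (simp add: field_simps)
      then have "\<tau>max * (\<tau> ?k * (norm (d ?k))\<^sup>2) \<le> \<tau>max * (\<Delta> j / (K * \<sigma>1))"
        using \<tau> by (intro mult_left_mono) auto
      moreover have "\<tau> ?k * (\<tau> ?k * (norm (d ?k))\<^sup>2) \<le> \<tau>max * (\<tau> ?k * (norm (d ?k))\<^sup>2)"
        using \<tau> by (intro mult_right_mono) auto
      ultimately have "\<tau> ?k * (\<tau> ?k * (norm (d ?k))\<^sup>2) \<le> \<tau>max / (K * \<sigma>1) * \<Delta> j" by simp
      moreover have "(norm (x (Suc ?k) - x ?k))\<^sup>2 = \<tau> ?k * (\<tau> ?k * (norm (d ?k))\<^sup>2)"
        using next_iterate[OF nz] by (simp add: power_mult_distrib power2_eq_square)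
      ultimately show ?case using \<tau>(1) by simp
    qed
    moreover have "(\<lambda>j. \<tau>max / (K * \<sigma>1) * \<Delta> j) \<longlonglongrightarrow> 0"
      by (intro tendsto_mult_right_zero \<Delta>)
    ultimately have "(\<lambda>j. (norm (x (Suc (r j)) - x (r j)))\<^sup>2) \<longlonglongrightarrow> 0"
      by (rule Lim_null_comparison)
    then have "(\<lambda>j. sqrt ((norm (x (Suc (r j)) - x (r j)))\<^sup>2)) \<longlonglongrightarrow> sqrt 0"
      by (rule tendsto_real_sqrt)
    then show ?thesis by (simp add: tendsto_norm_zero_iff)
  qed
  have "(\<lambda>j. x (Suc (r j))) \<longlonglongrightarrow> xbar"
    using tendsto_add[OF step_to_0 xr] by simp
  then have "(\<lambda>j. ?G (Suc (r j))) \<longlonglongrightarrow> grad \<phi> xbar"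
    by (rule isCont_tendsto_compose[OF contG])
  from tendsto_norm[OF tendsto_diff[OF this G]]
  have G_diff: "(\<lambda>j. norm (?G (Suc (r j)) - ?G (r j))) \<longlonglongrightarrow> 0" by simp
  have d_to_0: "(\<lambda>j. norm (d (r j))) \<longlonglongrightarrow> 0"
  proof -
    \<comment> \<open>The numerator is the bound on the directions used after Cauchy-Schwarz; the
      denominator combines the curvature factor \<open>1 - \<sigma>2\<close> with the descent
      constant \<open>K\<close>.\<close>
    define C where "C = 2 * \<gamma> / K / ((1 - \<sigma>2) * K)"
    have "eventually (\<lambda>j. norm ((norm (d (r j)))\<^sup>2) \<le> C * norm (?G (Suc (r j)) - ?G (r j)))
      sequentially"
      using ev_descent ev_bounded
    proof eventually_elim
      case (elim j)
      let ?k = "r j"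
      let ?D = "norm (?G (Suc ?k) - ?G ?k)"
      have "(1 - \<sigma>2) * (K * (norm (d ?k))\<^sup>2) \<le> (1 - \<sigma>2) * ?a ?k"
        using elim(1) \<open>\<sigma>2 < 1\<close> by (intro mult_left_mono) auto
      also have "\<dots> \<le> (?G (Suc ?k) - ?G ?k) \<bullet> d ?k" using curvature elim(1) by simp
      also have "\<dots> \<le> ?D * norm (d ?k)" by (rule norm_cauchy_schwarz)
      also have "\<dots> \<le> ?D * (2 * \<gamma> / K)" using elim(2) by (intro mult_left_mono) auto
      finally have "((1 - \<sigma>2) * K) * (norm (d ?k))\<^sup>2 \<le> 2 * \<gamma> / K * ?D"
        by (simp add: mult_ac)
      moreover have "(1 - \<sigma>2) * K > 0" using K \<open>\<sigma>2 < 1\<close> by simp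
      ultimately have "(norm (d ?k))\<^sup>2 \<le> 2 * \<gamma> / K * ?D / ((1 - \<sigma>2) * K)"
        by (subst pos_le_divide_eq) (simp_all only: mult.commute)
      then show ?case by (simp add: C_def)
    qed
    moreover have "(\<lambda>j. C * norm (?G (Suc (r j)) - ?G (r j))) \<longlonglongrightarrow> 0"
      using tendsto_mult_left[OF G_diff] by simp
    ultimately have "(\<lambda>j. (norm (d (r j)))\<^sup>2) \<longlonglongrightarrow> 0"
      by (rule Lim_null_comparison)
    then have "(\<lambda>j. sqrt ((norm (d (r j)))\<^sup>2)) \<longlonglongrightarrow> sqrt 0"
      by (rule tendsto_real_sqrt)
    then show ?thesis by simp
  qed

  \<comment> \<open>Passage to the limit in the Newton equation\<close>
  \<comment> \<open>One Lipschitz constant near \<open>xbar\<close> serves all late iterates of the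
    subsequence, so the factor multiplying the direction norm converges to a finite limit.\<close>
  obtain e L where e: "e > 0" and L: "L-lipschitz_on (ball xbar e) (grad \<phi>)"
    using assms(1) unfolding C11_def by blast
  have "eventually (\<lambda>j. x (r j) \<in> ball xbar e) sequentially"
    using e by (intro topological_tendstoD[OF xr]) auto
  then have "eventually (\<lambda>j. norm (?G (r j)) \<le>
      (L + c * norm (?G (r j)) powr \<rho> * m_upper\<^sup>2) * norm (d (r j))) sequentially"
    using ev_descent
  proof eventually_elim
    case (elim j)
    then show ?case
      using assms(13)[of "r j"]
      by (intro GRNM_W_step_norm_grad_le[OF step L open_ball _ \<open>c > 0\<close>]) auto
  qed
  \<comment> \<open>Positivity of \<open>\<gamma>\<close> ensures continuity of \<open>powr\<close>
    at this base. The right side tends to 0 and the gradient norms tend to \<open>\<gamma>\<close>,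
    contradicting that positivity.\<close>
  moreover have "(\<lambda>j. (L + c * norm (?G (r j)) powr \<rho> * m_upper\<^sup>2) * norm (d (r j))) \<longlonglongrightarrow>
      (L + c * \<gamma> powr \<rho> * m_upper\<^sup>2) * 0"
    using \<gamma> by (intro tendsto_intros nG d_to_0) auto
  ultimately have "\<gamma> \<le> (L + c * \<gamma> powr \<rho> * m_upper\<^sup>2) * 0"
    by (intro tendsto_le[OF sequentially_bot _ nG]) auto
  then show False using \<gamma> by simp
qed

end
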